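(* Let $n\ge 3$ and let $*:(\mathcal{Z}^n_s)^2\to\mathcal{Z}^n_s$ be an operation on the class $\mathcal{Z}^n_s$ of $o$-symmetric zonoids in $\mathbb{R}^n$. Then $*$ is projection covariant (or, equivalently, continuous in the Hausdorff metric and $GL(n)$ covariant) if and only if there are constants $a,b\ge 0$ such that $K*L=aK+bL$ for all $K,L\in\mathcal{Z}^n_s$, where $+$ denotes Minkowski addition.
   Context: A zonotope is a finite Minkowski sum of line segments in $\mathbb{R}^n$; a zonoid is a limit in the Hausdorff metric of zonotopes. $\mathcal{Z}^n_s$ is the class of $o$-symmetric ($K=-K$) zonoids in $\mathbb{R}^n$; these need not have nonempty interior. Minkowski addition is $X+Y=\{x+y:x\in X,\ y\in Y\}$, and $tX=\{tx:x\in X\}$. For a linear subspace $S$ of $\mathbb{R}^n$, $X|S$ denotes the orthogonal projection of $X$ onto $S$ (regarded as a subset of $\mathbb{R}^n$). The operation $*$ is projection covariant if $(K*L)|S=(K|S)*(L|S)$ for all $K,L\in\mathcal{Z}^n_s$ and all $k$-dimensional linear subspaces $S$ of $\mathbb{R}^n$, $1\le k\le n-1$. Continuity in the Hausdorff metric means: if $K_m\to M$ and $L_m\to N$ in the Hausdorff metric as $m\to\infty$, with all sets in $\mathcal{Z}^n_s$, then $K_m*L_m\to M*N$. The operation $*$ is $GL(n)$ covariant if $\phi(K*L)=\phi K*\phi L$ for all $\phi\in GL(n)$ and all $K,L\in\mathcal{Z}^n_s$. *)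

theory Defs
  imports "HOL-Analysis.Analysis" "HOL-Library.Set_Algebras"
begin

text \<open>
  Throughout, \<open>+\<close> and \<open>\<Sum>\<close> on sets are the Minkowski operations of
  \<^theory>\<open>HOL-Library.Set_Algebras\<close>, and the dilatate \<open>t X\<close> is \<open>(*\<^sub>R) t ` X\<close>.
\<close>

text \<open>Meaningful only for nonempty bounded sets; a metric on nonempty compact sets.\<close>

definition hausdorff_dist :: "'a::metric_space set \<Rightarrow> 'a set \<Rightarrow> real" where
  "hausdorff_dist K L = max (SUP x\<in>K. infdist x L) (SUP y\<in>L. infdist y K)"

definition hausdorff_tendsto :: "(nat \<Rightarrow> 'a::metric_space set) \<Rightarrow> 'a set \<Rightarrow> bool" where
  "hausdorff_tendsto X K \<longleftrightarrow> (\<lambda>m. hausdorff_dist (X m) K) \<longlonglongrightarrow> 0"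

definition zonotope :: "'a::euclidean_space set \<Rightarrow> bool" where
  "zonotope Z \<longleftrightarrow> (\<exists>(m::nat) p q. Z = (\<Sum>i<m. closed_segment (p i) (q i)))"

text \<open>Limits are taken in the space of nonempty compact sets, so both conditions are explicit:
  \<open>hausdorff_dist\<close> does not distinguish a set from its closure.\<close>

definition zonoid :: "'a::euclidean_space set \<Rightarrow> bool" where
  "zonoid K \<longleftrightarrow> compact K \<and> K \<noteq> {} \<and>
     (\<exists>Z. (\<forall>m. zonotope (Z m)) \<and> hausdorff_tendsto Z K)"

definition sym_zonoids :: "'a::euclidean_space set set" where
  "sym_zonoids = {K. zonoid K \<and> uminus ` K = K}"

definition set_proj :: "'a::euclidean_space set \<Rightarrow> 'a set \<Rightarrow> 'a set" where
  "set_proj X S = {y \<in> S. \<exists>x\<in>X. \<forall>s\<in>S. orthogonal (x - y) s}"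

definition projection_covariant ::
  "('a::euclidean_space set \<Rightarrow> 'a set \<Rightarrow> 'a set) \<Rightarrow> bool" where
  "projection_covariant star \<longleftrightarrow>
     (\<forall>K\<in>sym_zonoids. \<forall>L\<in>sym_zonoids. \<forall>S. subspace S \<and> 1 \<le> dim S \<and> dim S \<le> DIM('a) - 1 \<longrightarrow>
        set_proj (star K L) S = star (set_proj K S) (set_proj L S))"

definition hausdorff_continuous ::
  "('a::euclidean_space set \<Rightarrow> 'a set \<Rightarrow> 'a set) \<Rightarrow> bool" where
  "hausdorff_continuous star \<longleftrightarrow>
     (\<forall>X Y. \<forall>M\<in>sym_zonoids. \<forall>N\<in>sym_zonoids.
        (\<forall>m. X m \<in> sym_zonoids \<and> Y m \<in> sym_zonoids) \<and>
        hausdorff_tendsto X M \<and> hausdorff_tendsto Y N \<longrightarrow>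
        hausdorff_tendsto (\<lambda>m. star (X m) (Y m)) (star M N))"

definition GL_covariant ::
  "('a::euclidean_space set \<Rightarrow> 'a set \<Rightarrow> 'a set) \<Rightarrow> bool" where
  "GL_covariant star \<longleftrightarrow>
     (\<forall>\<phi>. linear \<phi> \<and> bij \<phi> \<longrightarrow>
        (\<forall>K\<in>sym_zonoids. \<forall>L\<in>sym_zonoids. \<phi> ` star K L = star (\<phi> ` K) (\<phi> ` L)))"

end

theory Submission
  imports Defs
begin

text \<open>
  Projecting onto lines shows that a projection covariant operation acts on support functions by
  \<open>h (K * L) = F (h K) (h L)\<close> for a positively homogeneous \<open>F\<close>. To see that \<open>F\<close> is linear, take
  \<open>K = [-e1, e1]\<close> and \<open>L = [-e2, e2] + [-e3, e3]\<close> for orthonormal \<open>e1, e2, e3\<close>, so that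
  \<open>F \<bar>x1\<bar> (\<bar>x2\<bar> + \<bar>x3\<bar>)\<close> is the support function of a zonoid \<open>Z\<close>. The slope of \<open>F 1\<close> at \<open>b > 0\<close> is the
  length of the face of \<open>Z\<close> in direction \<open>(1, b, 0)\<close>, a segment parallel to \<open>e3\<close>; faces of
  a zonoid in different directions can only share what the generating measure puts on the line of
  \<open>e3\<close>, and infinitely many excesses over that must be summable. As \<open>F 1\<close> is convex, its slope is
  constant. The measure is avoided by an inequality between second differences of the support
  function, which can be checked on segments and passes to limits.

  A continuous and \<open>GL(n)\<close> covariant operation is projection covariant because the orthogonal
  projection \<open>P\<close> is the limit of the invertible maps \<open>P + t I\<close>, \<open>t > 0\<close>.
\<close>

section \<open>The Hausdorff distance and zonoids\<close>

text \<open>Compactness of \<open>K\<close> bounds the distances to \<open>L\<close>, so the real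
  supremum in \<open>hausdorff_dist\<close> is a genuine one.\<close>

lemma le_hausdorff_dist:
  assumes "compact K" "compact L" "L \<noteq> {}" "x \<in> K"
  shows "infdist x L \<le> hausdorff_dist K L"
proof -
  obtain a where a: "a \<in> L" using assms by blast
  have "bdd_above ((\<lambda>x. infdist x L) ` K)"
    using assms(1) by (intro compact_imp_bounded bounded_imp_bdd_above compact_continuous_image continuous_intros)
  then have "infdist x L \<le> (SUP x\<in>K. infdist x L)"
    using assms(4) by (rule cSUP_upper2) simp
  then show ?thesis by (simp add: hausdorff_dist_def)
qed

lemma hausdorff_dist_commute: "hausdorff_dist K L = hausdorff_dist L K"
  by (simp add: hausdorff_dist_def max.commute)

lemma hausdorff_dist_nonneg:
  assumes "compact K" "K \<noteq> {}" "compact L" "L \<noteq> {}"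
  shows "0 \<le> hausdorff_dist K L"
  using le_hausdorff_dist[of K L] assms infdist_nonneg by (metis all_not_in_conv order_trans)

lemma hausdorff_dist_nearby:
  fixes K L :: "'a::heine_borel set"
  assumes "compact K" "compact L" "L \<noteq> {}" "x \<in> K"
  obtains y where "y \<in> L" "dist x y \<le> hausdorff_dist K L"
  using infdist_attains_inf[of L x] le_hausdorff_dist[OF assms] assms(2,3) compact_imp_closed
  by metis

lemma hausdorff_dist_le:
  assumes "K \<noteq> {}" "L \<noteq> {}"
    and "\<And>x. x \<in> K \<Longrightarrow> \<exists>y\<in>L. dist x y \<le> d"
    and "\<And>y. y \<in> L \<Longrightarrow> \<exists>x\<in>K. dist y x \<le> d"
  shows "hausdorff_dist K L \<le> d"
  unfolding hausdorff_dist_def max.bounded_iff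
  using assms by (auto intro!: cSUP_least intro: infdist_le2)

lemma hausdorff_tendsto_le:
  assumes "\<And>m. compact (X m) \<and> X m \<noteq> {}" "compact K" "K \<noteq> {}"
    and "\<And>m. hausdorff_dist (X m) K \<le> f m" "f \<longlonglongrightarrow> 0"
  shows "hausdorff_tendsto X K"
  unfolding hausdorff_tendsto_def
  by (rule tendsto_sandwich[OF _ _ tendsto_const assms(5)])
    (use assms in \<open>auto intro!: always_eventually hausdorff_dist_nonneg\<close>)

lemma hausdorff_tendsto_const: "K \<noteq> {} \<Longrightarrow> hausdorff_tendsto (\<lambda>_. K) K"
  by (simp add: hausdorff_tendsto_def hausdorff_dist_def)

text \<open>A point of one limit is close to a point of \<open>X m\<close>, which is close to a
  point of the other limit. As both limits are closed, each contains the other.\<close>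

lemma hausdorff_tendsto_unique:
  fixes K L :: "'a::heine_borel set"
  assumes X: "\<And>m. compact (X m) \<and> X m \<noteq> {}"
    and K: "compact K" "K \<noteq> {}" and L: "compact L" "L \<noteq> {}"
    and XK: "hausdorff_tendsto X K" and XL: "hausdorff_tendsto X L"
  shows "K = L"
proof -
  have "A \<subseteq> B" if A: "compact A" "A \<noteq> {}" and B: "compact B" "B \<noteq> {}"
    and XA: "hausdorff_tendsto X A" and XB: "hausdorff_tendsto X B" for A B
  proof
    fix x assume x: "x \<in> A"
    have le: "infdist x B \<le> hausdorff_dist (X m) A + hausdorff_dist (X m) B" for m
    proof -
      obtain y where y: "y \<in> X m" "dist x y \<le> hausdorff_dist A (X m)"
        using hausdorff_dist_nearby[of A "X m" x] A X x by blast
      obtain z where z: "z \<in> B" "dist y z \<le> hausdorff_dist (X m) B"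
        using hausdorff_dist_nearby[of "X m" B y] B X y by blast
      have "infdist x B \<le> dist x z" using z by (simp add: infdist_le)
      also have "\<dots> \<le> dist x y + dist y z" by (rule dist_triangle)
      finally show ?thesis using y z by (simp add: hausdorff_dist_commute)
    qed
    have "(\<lambda>m. hausdorff_dist (X m) A + hausdorff_dist (X m) B) \<longlonglongrightarrow> 0 + 0"
      using XA XB unfolding hausdorff_tendsto_def by (rule tendsto_add)
    then have "infdist x B \<le> 0 + 0"
      using le by (meson LIMSEQ_le_const)
    then have "infdist x B = 0" using infdist_nonneg[of x B] by linarith
    then show "x \<in> B" using B in_closed_iff_infdist_zero[of B x] compact_imp_closed by blast
  qed
  then show ?thesis using assms by blast
qed

lemma hausdorff_dist_image_le:
  fixes f :: "'a::heine_borel \<Rightarrow> 'b::metric_space"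
  assumes "compact K" "K \<noteq> {}" "compact L" "L \<noteq> {}" "0 \<le> B"
    and "\<And>x y. dist (f x) (f y) \<le> B * dist x y"
  shows "hausdorff_dist (f ` K) (f ` L) \<le> B * hausdorff_dist K L"
proof (rule hausdorff_dist_le)
  have near: "\<exists>y\<in>f ` B'. dist x y \<le> B * hausdorff_dist A B'"
    if AB: "compact A" "compact B'" "B' \<noteq> {}" "x \<in> f ` A" for x A B'
  proof -
    obtain a where a: "a \<in> A" "x = f a" using \<open>x \<in> f ` A\<close> by blast
    obtain b where b: "b \<in> B'" "dist a b \<le> hausdorff_dist A B'"
      using hausdorff_dist_nearby[OF AB(1-3) a(1)] .
    have "dist x (f b) \<le> B * hausdorff_dist A B'"
      using assms(6)[of a b] mult_left_mono[OF b(2) assms(5)] a(2) by simp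
    then show ?thesis using b by blast
  qed
  show "\<And>x. x \<in> f ` K \<Longrightarrow> \<exists>y\<in>f ` L. dist x y \<le> B * hausdorff_dist K L"
    and "\<And>y. y \<in> f ` L \<Longrightarrow> \<exists>x\<in>f ` K. dist y x \<le> B * hausdorff_dist K L"
    using near[of K L] near[of L K] assms(1-4) hausdorff_dist_commute[of K L] by simp_all
qed (use assms in auto)

lemma hausdorff_tendsto_linear_image:
  fixes f :: "'a::euclidean_space \<Rightarrow> 'b::euclidean_space"
  assumes "linear f" and X: "\<And>m. compact (X m) \<and> X m \<noteq> {}" and K: "compact K" "K \<noteq> {}"
    and "hausdorff_tendsto X K"
  shows "hausdorff_tendsto (\<lambda>m. f ` X m) (f ` K)"
proof -
  obtain B where B: "B > 0" "\<And>x. norm (f x) \<le> B * norm x"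
    using linear_bounded_pos[OF assms(1)] by blast
  have cont: "continuous_on S f" for S using assms(1) by (simp add: linear_continuous_on linear_linear)
  have "dist (f x) (f y) \<le> B * dist x y" for x y
    using B(2)[of "x - y"] by (simp add: dist_norm linear_diff[OF assms(1)])
  then show ?thesis
    using X K B(1) tendsto_mult_right_zero[of "\<lambda>m. hausdorff_dist (X m) K" sequentially B] assms(5) cont
    by (intro hausdorff_tendsto_le[where f="\<lambda>m. B * hausdorff_dist (X m) K"])
      (auto simp: hausdorff_tendsto_def intro!: hausdorff_dist_image_le compact_continuous_image)
qed

lemma compact_set_plus:
  fixes K L :: "'a::real_normed_vector set"
  assumes "compact K" "compact L" shows "compact (K + L)"
proof -
  have "K + L = {x + y |x y. x \<in> K \<and> y \<in> L}" by (auto simp: set_plus_def)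
  then show ?thesis using compact_sums[OF assms] by simp
qed

lemma set_plus_eq_empty: "(K::'a::plus set) + L = {} \<longleftrightarrow> K = {} \<or> L = {}"
  by (auto simp: set_plus_def)

lemma hausdorff_dist_plus_le:
  fixes K L :: "'a::euclidean_space set"
  assumes "compact K" "K \<noteq> {}" "compact L" "L \<noteq> {}" "compact K'" "K' \<noteq> {}" "compact L'" "L' \<noteq> {}"
  shows "hausdorff_dist (K + L) (K' + L') \<le> hausdorff_dist K K' + hausdorff_dist L L'"
proof (rule hausdorff_dist_le)
  have near: "\<exists>y\<in>C + D. dist x y \<le> hausdorff_dist A C + hausdorff_dist B D"
    if ABCD: "compact A" "compact B" "compact C" "compact D" "C \<noteq> {}" "D \<noteq> {}" "x \<in> A + B"
    for x and A B C D :: "'a set"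
  proof -
    obtain a b where ab: "a \<in> A" "b \<in> B" "x = a + b" using \<open>x \<in> A + B\<close> by (auto elim: set_plus_elim)
    obtain c where c: "c \<in> C" "dist a c \<le> hausdorff_dist A C"
      using hausdorff_dist_nearby ABCD(1,3,5) ab(1) by blast
    obtain d where d: "d \<in> D" "dist b d \<le> hausdorff_dist B D"
      using hausdorff_dist_nearby ABCD(2,4,6) ab(2) by blast
    have "dist x (c + d) \<le> hausdorff_dist A C + hausdorff_dist B D"
      using dist_triangle_add[of a b c d] ab c d by simp
    then show ?thesis using c d by (meson set_plus_intro)
  qed
  show "\<And>x. x \<in> K + L \<Longrightarrow> \<exists>y\<in>K' + L'. dist x y \<le> hausdorff_dist K K' + hausdorff_dist L L'"
    and "\<And>x. x \<in> K' + L' \<Longrightarrow> \<exists>y\<in>K + L. dist x y \<le> hausdorff_dist K K' + hausdorff_dist L L'"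
    using near[of K L K' L'] near[of K' L' K L] assms
      hausdorff_dist_commute[of K K'] hausdorff_dist_commute[of L L'] by simp_all
qed (use assms in \<open>auto simp: set_plus_eq_empty\<close>)

lemma hausdorff_tendsto_plus:
  fixes K L :: "'a::euclidean_space set"
  assumes X: "\<And>m. compact (X m) \<and> X m \<noteq> {}" and K: "compact K" "K \<noteq> {}"
    and Y: "\<And>m. compact (Y m) \<and> Y m \<noteq> {}" and L: "compact L" "L \<noteq> {}"
    and "hausdorff_tendsto X K" "hausdorff_tendsto Y L"
  shows "hausdorff_tendsto (\<lambda>m. X m + Y m) (K + L)"
proof (rule hausdorff_tendsto_le)
  show "hausdorff_dist (X m + Y m) (K + L) \<le> hausdorff_dist (X m) K + hausdorff_dist (Y m) L" for m
    using X Y K L by (intro hausdorff_dist_plus_le) auto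
  show "(\<lambda>m. hausdorff_dist (X m) K + hausdorff_dist (Y m) L) \<longlonglongrightarrow> 0"
    using assms(7,8) unfolding hausdorff_tendsto_def by (rule tendsto_add_zero)
qed (use X Y K L in \<open>auto simp: compact_set_plus set_plus_eq_empty\<close>)

section \<open>Zonotopes, zonoids and their linear images\<close>

lemma zonotope_induct [consumes 1, case_names zero plus]:
  assumes "zonotope Z" and "P {0}"
    and step: "\<And>Z p q. zonotope Z \<Longrightarrow> P Z \<Longrightarrow> P (Z + closed_segment p q)"
  shows "P Z"
proof -
  obtain m :: nat and p q where Z: "Z = (\<Sum>i<m. closed_segment (p i) (q i))"
    using assms(1) unfolding zonotope_def by blast
  have "P (\<Sum>i<m. closed_segment (p i) (q i))"
  proof (induction m)
    case 0
    then show ?case using assms(2) by (simp add: set_zero)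
  next
    case (Suc m)
    have "zonotope (\<Sum>i<m. closed_segment (p i) (q i))"
      unfolding zonotope_def by blast
    then show ?case using step Suc by simp
  qed
  then show ?thesis using Z by simp
qed

lemma zonotope_zero: "zonotope {0}"
  unfolding zonotope_def by (rule exI[of _ 0]) (simp add: set_zero)

lemma zonotope_plus_segment:
  assumes "zonotope Z" shows "zonotope (Z + closed_segment a b)"
proof -
  obtain m :: nat and p q where Z: "Z = (\<Sum>i<m. closed_segment (p i) (q i))"
    using assms(1) unfolding zonotope_def by blast
  \<comment> \<open>The new segment is stored at index \<open>m\<close>, which the sum over
    \<open>i < m\<close> does not reach.\<close>
  have "Z + closed_segment a b = (\<Sum>i<Suc m. closed_segment ((p(m := a)) i) ((q(m := b)) i))"
    unfolding Z by simp
  then show ?thesis unfolding zonotope_def by blast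
qed

lemma zonotope_segment: "zonotope (closed_segment a b)"
  using zonotope_plus_segment[OF zonotope_zero, of a b] by (simp flip: set_zero)

lemma linear_image_plus: "linear f \<Longrightarrow> f ` (K + L) = f ` K + f ` L"
  by (force simp: set_plus_def image_iff linear_add)

lemma zonotope_linear_image: "zonotope Z \<Longrightarrow> linear f \<Longrightarrow> zonotope (f ` Z)"
proof (induction rule: zonotope_induct)
  case zero
  then show ?case by (simp add: linear_0 zonotope_zero)
next
  case (plus Z p q)
  then show ?case
    by (simp add: linear_image_plus zonotope_plus_segment flip: closed_segment_linear_image)
qed

lemma zonotope_compact_convex: "zonotope Z \<Longrightarrow> compact Z \<and> Z \<noteq> {} \<and> convex Z"
  by (induction rule: zonotope_induct)
    (auto simp: compact_set_plus convex_set_plus set_plus_eq_empty)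

lemma zonoid_zonotope: "zonotope Z \<Longrightarrow> zonoid Z"
  unfolding zonoid_def using zonotope_compact_convex hausdorff_tendsto_const by metis

lemma zonoid_linear_image:
  fixes f :: "'a::euclidean_space \<Rightarrow> 'b::euclidean_space"
  assumes "zonoid K" "linear f" shows "zonoid (f ` K)"
proof -
  obtain Z where Z: "\<And>m. zonotope (Z m)" "hausdorff_tendsto Z K" and K: "compact K" "K \<noteq> {}"
    using assms(1) unfolding zonoid_def by blast
  have "hausdorff_tendsto (\<lambda>m. f ` Z m) (f ` K)"
    using assms(2) Z K zonotope_compact_convex by (intro hausdorff_tendsto_linear_image) auto
  moreover have "compact (f ` K)"
    using K assms(2) by (intro compact_continuous_image linear_continuous_on) (auto simp: linear_linear)
  ultimately show ?thesis
    unfolding zonoid_def using Z(1) zonotope_linear_image[OF _ assms(2)] K(2)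
    by (intro conjI exI[of _ "\<lambda>m. f ` Z m"]) auto
qed

text \<open>Convexity survives Hausdorff limits: replacing the endpoints by nearby points of the
  convex set \<open>Z m\<close> and returning to \<open>K\<close> costs one Hausdorff distance each.
  Without convexity, support functions would not determine zonoids.\<close>

lemma zonoid_convex:
  fixes K :: "'a::euclidean_space set"
  assumes "zonoid K" shows "convex K"
proof (rule convexI)
  obtain Z where Z: "\<And>m. zonotope (Z m)" "hausdorff_tendsto Z K" and K: "compact K" "K \<noteq> {}"
    using assms(1) unfolding zonoid_def by blast
  fix x y and u v :: real
  assume xy: "x \<in> K" "y \<in> K" and uv: "0 \<le> u" "0 \<le> v" "u + v = 1"
  have le: "infdist (u *\<^sub>R x + v *\<^sub>R y) K \<le> 2 * hausdorff_dist (Z m) K" for m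
  proof -
    let ?d = "hausdorff_dist (Z m) K"
    have Zm: "compact (Z m)" "Z m \<noteq> {}" "convex (Z m)" using Z(1) zonotope_compact_convex by blast+
    obtain a where a: "a \<in> Z m" "dist x a \<le> ?d"
      using hausdorff_dist_nearby[OF K(1) Zm(1,2) xy(1)] by (metis hausdorff_dist_commute)
    obtain b where b: "b \<in> Z m" "dist y b \<le> ?d"
      using hausdorff_dist_nearby[OF K(1) Zm(1,2) xy(2)] by (metis hausdorff_dist_commute)
    have ab: "u *\<^sub>R a + v *\<^sub>R b \<in> Z m" using convexD[OF Zm(3) a(1) b(1) uv] .
    obtain c where c: "c \<in> K" "dist (u *\<^sub>R a + v *\<^sub>R b) c \<le> ?d"
      using hausdorff_dist_nearby[OF Zm(1) K ab] .
    have "dist (u *\<^sub>R x + v *\<^sub>R y) (u *\<^sub>R a + v *\<^sub>R b) \<le> dist (u *\<^sub>R x) (u *\<^sub>R a) + dist (v *\<^sub>R y) (v *\<^sub>R b)"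
      by (rule dist_triangle_add)
    also have "\<dots> = u * dist x a + v * dist y b"
      using uv by (simp add: dist_norm flip: scaleR_diff_right)
    also have "\<dots> \<le> u * ?d + v * ?d" using a b uv by (intro add_mono mult_left_mono) auto
    also have "\<dots> = ?d" using uv by (metis distrib_right mult_1)
    finally have "dist (u *\<^sub>R x + v *\<^sub>R y) c \<le> 2 * ?d"
      using c(2) dist_triangle[of "u *\<^sub>R x + v *\<^sub>R y" c "u *\<^sub>R a + v *\<^sub>R b"] by linarith
    then show ?thesis using c(1) infdist_le2 by blast
  qed
  have "(\<lambda>m. 2 * hausdorff_dist (Z m) K) \<longlonglongrightarrow> 0"
    using Z(2) unfolding hausdorff_tendsto_def by (rule tendsto_mult_right_zero)
  then have "infdist (u *\<^sub>R x + v *\<^sub>R y) K \<le> 0" using le by (meson LIMSEQ_le_const)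
  then show "u *\<^sub>R x + v *\<^sub>R y \<in> K"
    using in_closed_iff_infdist_zero[OF compact_imp_closed[OF K(1)] K(2)] infdist_nonneg by (metis order_antisym)
qed

lemma sym_zonoidsD:
  assumes "K \<in> sym_zonoids"
  shows "zonoid K" "compact K" "K \<noteq> {}" "convex K" "\<And>x. x \<in> K \<Longrightarrow> - x \<in> K"
  using assms zonoid_convex by (auto simp: sym_zonoids_def zonoid_def)

lemma sym_zonoids_linear_image:
  fixes f :: "'a::euclidean_space \<Rightarrow> 'b::euclidean_space"
  assumes "K \<in> sym_zonoids" "linear f" shows "f ` K \<in> sym_zonoids"
proof -
  have "uminus ` f ` K = f ` uminus ` K"
    by (simp add: image_image linear_neg[OF assms(2)])
  then show ?thesis
    using assms zonoid_linear_image[of K f] by (simp add: sym_zonoids_def)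
qed

section \<open>Support functions\<close>

definition support_fun :: "'a::euclidean_space set \<Rightarrow> 'a \<Rightarrow> real" where
  "support_fun K x = (SUP k\<in>K. k \<bullet> x)"

lemma support_fun_eqI:
  assumes "k \<in> K" "k \<bullet> x = c" "\<And>k. k \<in> K \<Longrightarrow> k \<bullet> x \<le> c"
  shows "support_fun K x = c"
  unfolding support_fun_def using assms by (intro cSup_eq_maximum) auto

lemma support_fun_attained:
  assumes "compact K" "K \<noteq> {}"
  obtains k where "k \<in> K" "k \<bullet> x = support_fun K x"
proof -
  have "continuous_on K (\<lambda>k. k \<bullet> x)" by (intro continuous_intros)
  then obtain k where "k \<in> K" "\<And>y. y \<in> K \<Longrightarrow> y \<bullet> x \<le> k \<bullet> x"
    using continuous_attains_sup[OF assms] by blast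
  then show thesis using that support_fun_eqI by metis
qed

lemma support_fun_upper:
  assumes "compact K" "k \<in> K"
  shows "k \<bullet> x \<le> support_fun K x"
proof -
  have "continuous_on K (\<lambda>k. k \<bullet> x)" by (intro continuous_intros)
  then obtain l where l: "l \<in> K" "\<And>y. y \<in> K \<Longrightarrow> y \<bullet> x \<le> l \<bullet> x"
    using continuous_attains_sup[OF assms(1)] assms(2) by blast
  have "support_fun K x = l \<bullet> x" using l by (intro support_fun_eqI) auto
  then show ?thesis using l assms by simp
qed

lemma support_fun_plus:
  assumes "compact K" "K \<noteq> {}" "compact L" "L \<noteq> {}"
  shows "support_fun (K + L) x = support_fun K x + support_fun L x"
proof -
  obtain k where k: "k \<in> K" "k \<bullet> x = support_fun K x" using support_fun_attained assms(1,2) .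
  obtain l where l: "l \<in> L" "l \<bullet> x = support_fun L x" using support_fun_attained assms(3,4) .
  show ?thesis
    by (rule support_fun_eqI[of "k + l"])
      (use k l assms in \<open>auto elim!: set_plus_elim simp: inner_add_left intro!: add_mono support_fun_upper\<close>)
qed

lemma support_fun_scaleR_image:
  assumes "compact K" "K \<noteq> {}" "0 \<le> a"
  shows "support_fun ((*\<^sub>R) a ` K) x = a * support_fun K x"
proof -
  obtain k where k: "k \<in> K" "k \<bullet> x = support_fun K x" using support_fun_attained assms(1,2) .
  show ?thesis
    by (rule support_fun_eqI[of "a *\<^sub>R k"])
      (use k assms in \<open>auto intro!: mult_left_mono support_fun_upper\<close>)
qed

lemma support_fun_scaleR:
  assumes "compact K" "K \<noteq> {}" "0 \<le> a"
  shows "support_fun K (a *\<^sub>R x) = a * support_fun K x"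
proof -
  obtain k where k: "k \<in> K" "k \<bullet> x = support_fun K x" using support_fun_attained assms(1,2) .
  show ?thesis
    by (rule support_fun_eqI[of k])
      (use k assms in \<open>auto intro!: mult_left_mono support_fun_upper\<close>)
qed

lemma support_fun_add_le:
  assumes "compact K" "K \<noteq> {}"
  shows "support_fun K (x + y) \<le> support_fun K x + support_fun K y"
proof -
  obtain k where k: "k \<in> K" "k \<bullet> (x + y) = support_fun K (x + y)" using support_fun_attained assms .
  then show ?thesis
    using support_fun_upper[OF assms(1) k(1), of x] support_fun_upper[OF assms(1) k(1), of y]
    by (simp add: inner_add_right)
qed

text \<open>A linear functional on a segment is maximal at an endpoint, and max(a, b) = (a + b)/2 +
  |b - a|/2. This form splits off the linear part, which second differences do not see.\<close>

lemma support_fun_segment: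
  "support_fun (closed_segment p q) x = (p + q) \<bullet> x / 2 + \<bar>(q - p) \<bullet> x\<bar> / 2"
proof (rule support_fun_eqI)
  show "(if p \<bullet> x \<le> q \<bullet> x then q else p) \<in> closed_segment p q" by simp
  show "(if p \<bullet> x \<le> q \<bullet> x then q else p) \<bullet> x = (p + q) \<bullet> x / 2 + \<bar>(q - p) \<bullet> x\<bar> / 2"
    by (simp add: field_simps inner_diff_left inner_add_left)
  fix k assume "k \<in> closed_segment p q"
  then obtain u where u: "0 \<le> u" "u \<le> 1" "k = (1 - u) *\<^sub>R p + u *\<^sub>R q"
    by (auto simp: in_segment)
  have "k \<bullet> x = p \<bullet> x + u * ((q - p) \<bullet> x)" by (simp add: u algebra_simps)
  moreover have "u * ((q - p) \<bullet> x) \<le> max 0 ((q - p) \<bullet> x)"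
    using u mult_left_le_one_le[of "(q - p) \<bullet> x" u] mult_nonneg_nonpos[of u "(q - p) \<bullet> x"]
    by (cases "0 \<le> (q - p) \<bullet> x") auto
  ultimately show "k \<bullet> x \<le> (p + q) \<bullet> x / 2 + \<bar>(q - p) \<bullet> x\<bar> / 2"
    by (simp add: inner_add_left inner_diff_left field_simps max_def split: if_splits)
qed

lemma support_fun_symmetric_segment: "support_fun (closed_segment (- w) w) x = \<bar>w \<bullet> x\<bar>"
  by (simp add: support_fun_segment flip: scaleR_2)

text \<open>Cauchy-Schwarz for the difference between a maximizing point of one set and a nearby
  point of the other. Hausdorff convergence therefore gives pointwise convergence of support
  functions.\<close>

lemma support_fun_le_hausdorff:
  assumes "compact K" "K \<noteq> {}" "compact L" "L \<noteq> {}"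
  shows "\<bar>support_fun K x - support_fun L x\<bar> \<le> hausdorff_dist K L * norm x"
proof -
  have le: "support_fun A x \<le> support_fun B x + hausdorff_dist A B * norm x"
    if A: "compact A" "A \<noteq> {}" and B: "compact B" "B \<noteq> {}" for A B
  proof -
    obtain k where k: "k \<in> A" "k \<bullet> x = support_fun A x" using support_fun_attained A .
    obtain l where l: "l \<in> B" "dist k l \<le> hausdorff_dist A B"
      using hausdorff_dist_nearby[OF A(1) B k(1)] .
    have "k \<bullet> x = l \<bullet> x + (k - l) \<bullet> x" by (simp add: inner_diff_left)
    also have "(k - l) \<bullet> x \<le> norm (k - l) * norm x" by (rule norm_cauchy_schwarz)
    also have "\<dots> \<le> hausdorff_dist A B * norm x"
      using l(2) by (intro mult_right_mono) (auto simp: dist_norm)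
    also have "l \<bullet> x \<le> support_fun B x" using support_fun_upper[OF B(1) l(1)] .
    finally show ?thesis using k by simp
  qed
  show ?thesis using le[of K L] le[of L K] assms by (simp add: hausdorff_dist_commute[of L K])
qed

lemma support_fun_tendsto:
  assumes X: "\<And>m. compact (X m) \<and> X m \<noteq> {}" and K: "compact K" "K \<noteq> {}"
    and "hausdorff_tendsto X K"
  shows "(\<lambda>m. support_fun (X m) x) \<longlonglongrightarrow> support_fun K x"
proof (rule LIM_zero_cancel, rule Lim_null_comparison)
  show "\<forall>\<^sub>F m in sequentially. norm (support_fun (X m) x - support_fun K x) \<le> hausdorff_dist (X m) K * norm x"
    using X K by (auto intro!: always_eventually support_fun_le_hausdorff)
  show "(\<lambda>m. hausdorff_dist (X m) K * norm x) \<longlonglongrightarrow> 0"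
    using assms(4) unfolding hausdorff_tendsto_def by (rule tendsto_mult_left_zero)
qed

text \<open>A point of \<open>K\<close> outside \<open>L\<close> is strictly separated from
  \<open>L\<close> by a hyperplane. In the normal direction pointing away from \<open>L\<close>,
  which is \<open>- a\<close> below, the support function of \<open>K\<close> would exceed that of
  \<open>L\<close>.\<close>

lemma support_fun_subset:
  assumes "compact K" "K \<noteq> {}" "compact L" "L \<noteq> {}" "convex L"
    and "\<And>x. support_fun K x \<le> support_fun L x"
  shows "K \<subseteq> L"
proof
  fix k assume k: "k \<in> K"
  show "k \<in> L"
  proof (rule ccontr)
    assume "k \<notin> L"
    then obtain a b where ab: "a \<bullet> k < b" "\<And>x. x \<in> L \<Longrightarrow> b < a \<bullet> x"
      using separating_hyperplane_closed_point[OF assms(5) compact_imp_closed[OF assms(3)]] by blast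
    obtain l where l: "l \<in> L" "l \<bullet> (- a) = support_fun L (- a)"
      using support_fun_attained assms(3,4) .
    have "k \<bullet> (- a) \<le> support_fun K (- a)" using support_fun_upper assms(1) k .
    then show False using assms(6)[of "- a"] l ab(1) ab(2)[OF l(1)] by (simp add: inner_commute)
  qed
qed

lemma support_fun_inject:
  assumes "compact K" "K \<noteq> {}" "convex K" "compact L" "L \<noteq> {}" "convex L"
    and "\<And>x. support_fun K x = support_fun L x"
  shows "K = L"
  using support_fun_subset[of K L] support_fun_subset[of L K] assms by auto

lemma support_fun_uminus:
  assumes "K \<in> sym_zonoids" shows "support_fun K (- x) = support_fun K x"
proof -
  note K = sym_zonoidsD[OF assms]
  obtain k where k: "k \<in> K" "k \<bullet> x = support_fun K x" using support_fun_attained K(2,3) .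
  show ?thesis
  proof (rule support_fun_eqI[of "- k"])
    fix l assume "l \<in> K"
    then show "l \<bullet> - x \<le> support_fun K x"
      using support_fun_upper[OF K(2) K(5), of l x] by simp
  qed (use k K in auto)
qed

text \<open>Subadditivity and evenness: 0 = h(0) <= h(x) + h(-x) = 2 h(x).\<close>

lemma support_fun_sym_nonneg:
  assumes "K \<in> sym_zonoids" shows "0 \<le> support_fun K x"
  using support_fun_add_le[of K x "- x"] support_fun_uminus[OF assms] sym_zonoidsD[OF assms]
    support_fun_scaleR[of K 0 x] by simp

lemma support_fun_abs_scaleR:
  assumes "K \<in> sym_zonoids" shows "support_fun K (c *\<^sub>R x) = \<bar>c\<bar> * support_fun K x"
  using support_fun_scaleR[of K "\<bar>c\<bar>" x] support_fun_uminus[OF assms, of "c *\<^sub>R x"]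
    sym_zonoidsD[OF assms] by (cases "0 \<le> c") auto

lemma sym_zonoids_segment: "closed_segment (- w) w \<in> sym_zonoids"
proof -
  have "uminus ` closed_segment (- w) w = closed_segment (- w) w"
    using closed_segment_linear_image[of uminus "- w" w]
    by (simp add: linear_uminus closed_segment_commute)
  then show ?thesis by (simp add: sym_zonoids_def zonoid_zonotope zonotope_segment)
qed

lemma sym_zonoids_segment_sum:
  "closed_segment (- v) v + closed_segment (- w) w \<in> sym_zonoids"
proof -
  have "uminus ` (closed_segment (- v) v + closed_segment (- w) w)
    = closed_segment (- v) v + closed_segment (- w) w"
    using sym_zonoids_segment[of v] sym_zonoids_segment[of w]
    by (simp add: linear_image_plus linear_uminus sym_zonoids_def)
  then show ?thesis
    by (simp add: sym_zonoids_def zonoid_zonotope zonotope_segment zonotope_plus_segment)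
qed

section \<open>Orthogonal projections of sets\<close>

lemma set_proj_span:
  assumes "finite B" "pairwise orthogonal B" "\<And>b. b \<in> B \<Longrightarrow> norm b = 1"
  shows "set_proj X (span B) = (\<lambda>x. \<Sum>b\<in>B. (x \<bullet> b) *\<^sub>R b) ` X"
proof -
  let ?P = "\<lambda>x. \<Sum>b\<in>B. (x \<bullet> b) *\<^sub>R b"
  have in_span: "?P x \<in> span B" for x by (intro span_sum span_scale span_base)
  have orth: "orthogonal (x - ?P x) s" if s: "s \<in> span B" for x s
  proof (rule orthogonal_to_span[OF s])
    fix b assume b: "b \<in> B"
    have "?P x \<bullet> b = (\<Sum>c\<in>B. if c = b then x \<bullet> b else 0)"
      unfolding inner_sum_left
    proof (rule sum.cong)
      fix c assume "c \<in> B"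
      then show "(x \<bullet> c) *\<^sub>R c \<bullet> b = (if c = b then x \<bullet> b else 0)"
        using assms(2,3) b by (auto simp: pairwise_def orthogonal_def norm_eq_1)
    qed simp
    also have "\<dots> = x \<bullet> b" using b assms(1) by simp
    finally show "orthogonal (x - ?P x) b" by (simp add: orthogonal_def inner_diff_left)
  qed
  have unique: "y = ?P x" if y: "y \<in> span B" "\<forall>s\<in>span B. orthogonal (x - y) s" for x y
  proof -
    have "?P x - y \<in> span B" using y in_span span_diff by blast
    then have "orthogonal (x - y) (?P x - y)" "orthogonal (x - ?P x) (?P x - y)"
      using y orth by blast+
    then have "(?P x - y) \<bullet> (?P x - y) = 0"
      unfolding orthogonal_def by (simp add: inner_diff_left)
    then show ?thesis by simp
  qed
  show ?thesis
    unfolding set_proj_def using in_span orth unique by blast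
qed

text \<open>In an orthonormal basis the inner product of \<open>x\<close> and \<open>P x\<close> is
  a sum of squares. Its sign is recorded because it makes P + t I injective for t > 0.\<close>

lemma set_proj_eq_linear_image:
  fixes S :: "'a::euclidean_space set"
  assumes "subspace S"
  shows "\<exists>P. linear P \<and> (\<forall>x. 0 \<le> x \<bullet> P x) \<and> (\<forall>X. set_proj X S = P ` X)"
proof -
  obtain B where B: "pairwise orthogonal B" "\<And>x. x \<in> B \<Longrightarrow> norm x = 1" "independent B" "span B = S"
    using orthonormal_basis_subspace[OF assms] by metis
  have "finite B" using B(3) by (rule independent_imp_finite)
  then show ?thesis
    using set_proj_span[OF _ B(1,2)] B(4)
    by (intro exI[of _ "\<lambda>x. \<Sum>b\<in>B. (x \<bullet> b) *\<^sub>R b"])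
      (auto intro!: linear_compose_sum linearI simp: algebra_simps inner_sum_right sum_nonneg)
qed

lemma set_proj_line:
  assumes "norm u = 1" shows "set_proj X (span {u}) = (\<lambda>x. (x \<bullet> u) *\<^sub>R u) ` X"
  using set_proj_span[of "{u}" X] assms by simp

text \<open>A maximizing point and its negative project to the two endpoints; the support bounds for
  a point and its negative confine everything else. A projection to a line thus retains only the
  number \<open>support_fun K u\<close>.\<close>

lemma set_proj_line_sym_zonoid:
  assumes "K \<in> sym_zonoids" "norm u = 1"
  shows "set_proj K (span {u}) = closed_segment (- (support_fun K u *\<^sub>R u)) (support_fun K u *\<^sub>R u)"
proof -
  note K = sym_zonoidsD[OF assms(1)]
  obtain k where k: "k \<in> K" "k \<bullet> u = support_fun K u" using support_fun_attained K(2,3) .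
  have lin: "linear (\<lambda>x. (x \<bullet> u) *\<^sub>R u)" by (intro linearI) (simp_all add: algebra_simps)
  show ?thesis
    unfolding set_proj_line[OF assms(2)]
  proof
    have sub: "closed_segment (- k) k \<subseteq> K" using k K by (simp add: closed_segment_subset)
    have "closed_segment (- (support_fun K u *\<^sub>R u)) (support_fun K u *\<^sub>R u)
       = (\<lambda>x. (x \<bullet> u) *\<^sub>R u) ` closed_segment (- k) k"
      using closed_segment_linear_image[OF lin, of "- k" k] k by simp
    then show "closed_segment (- (support_fun K u *\<^sub>R u)) (support_fun K u *\<^sub>R u) \<subseteq> (\<lambda>x. (x \<bullet> u) *\<^sub>R u) ` K"
      using sub by blast
    show "(\<lambda>x. (x \<bullet> u) *\<^sub>R u) ` K \<subseteq> closed_segment (- (support_fun K u *\<^sub>R u)) (support_fun K u *\<^sub>R u)"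
    proof clarify
      fix x assume x: "x \<in> K"
      have "x \<bullet> u \<le> support_fun K u" "- support_fun K u \<le> x \<bullet> u"
        using support_fun_upper[OF K(2) x, of u] support_fun_upper[OF K(2) K(5)[OF x], of u] by auto
      then have "x \<bullet> u \<in> closed_segment (- support_fun K u) (support_fun K u)"
        by (simp add: closed_segment_eq_real_ivl)
      moreover have "linear (\<lambda>t::real. t *\<^sub>R u)" by (intro linearI) (simp_all add: algebra_simps)
      ultimately show "(x \<bullet> u) *\<^sub>R u \<in> closed_segment (- (support_fun K u *\<^sub>R u)) (support_fun K u *\<^sub>R u)"
        using closed_segment_linear_image[of "\<lambda>t::real. t *\<^sub>R u" "- support_fun K u" "support_fun K u"]
        by auto
    qed
  qed
qed

section \<open>Second differences of zonoid support functions\<close>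

text \<open>Zero for linear functions, hence blind to translations of a set. For a support function
  and small \<open>v\<close>, it is to first order half the width along \<open>v\<close> of the face
  in direction \<open>u\<close>.\<close>

definition second_diff :: "('a::real_vector \<Rightarrow> real) \<Rightarrow> 'a \<Rightarrow> 'a \<Rightarrow> real" where
  "second_diff h u v = (h (u + v) + h (u - v)) / 2 - h u"

lemma second_diff_support_fun_plus:
  assumes "compact K" "K \<noteq> {}" "compact L" "L \<noteq> {}"
  shows "second_diff (support_fun (K + L)) u v
       = second_diff (support_fun K) u v + second_diff (support_fun L) u v"
  by (simp add: second_diff_def support_fun_plus[OF assms] field_simps)

text \<open>Since (|a + b| + |a - b|)/2 = max(|a|, |b|), a segment contributes only if its direction
  is closer to orthogonal to \<open>u\<close> than to \<open>v\<close>, measured by inner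
  products.\<close>

lemma second_diff_support_fun_segment:
  "second_diff (support_fun (closed_segment p q)) u v = max 0 (\<bar>(q - p) \<bullet> v\<bar> - \<bar>(q - p) \<bullet> u\<bar>) / 2"
proof -
  have "(\<bar>a + b\<bar> + \<bar>a - b\<bar>) / 2 - \<bar>a\<bar> = max 0 (\<bar>b\<bar> - \<bar>a\<bar>)" for a b :: real
    by (auto simp: abs_if max_def)
  from this[of "(q - p) \<bullet> u" "(q - p) \<bullet> v"] show ?thesis
    by (simp add: second_diff_def support_fun_segment inner_add_right inner_diff_right field_simps)
qed

text \<open>If two terms on the left are nonzero, then \<open>\<bar>p\<bar> \<le> (2 N + 1) \<epsilon> \<bar>r\<bar>\<close> and the last term absorbs
  the whole sum; otherwise the sum is at most one term.\<close>

lemma sum_hat_le: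
  fixes p q r \<epsilon> \<delta> :: real and N :: nat
  assumes "0 < \<epsilon>" "(2 * real N + 1) * \<epsilon> < \<delta>"
  shows "(\<Sum>i=1..N. max 0 (\<epsilon> * \<bar>r\<bar> - \<bar>p + i * q\<bar>))
    \<le> \<epsilon> * \<bar>r\<bar> + N * \<epsilon> / (\<delta> - (2 * real N + 1) * \<epsilon>) * max 0 (\<delta> * \<bar>r\<bar> - \<bar>p\<bar>)"
proof -
  define hat where "hat i = max 0 (\<epsilon> * \<bar>r\<bar> - \<bar>p + real i * q\<bar>)" for i :: nat
  have hat: "0 \<le> hat i" "hat i \<le> \<epsilon> * \<bar>r\<bar>" for i using assms by (auto simp: hat_def)
  have rest: "0 \<le> N * \<epsilon> / (\<delta> - (2 * real N + 1) * \<epsilon>) * max 0 (\<delta> * \<bar>r\<bar> - \<bar>p\<bar>)"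
    using assms by (intro mult_nonneg_nonneg divide_nonneg_pos) auto
  have "sum hat {1..N} \<le> \<epsilon> * \<bar>r\<bar> + N * \<epsilon> / (\<delta> - (2 * real N + 1) * \<epsilon>) * max 0 (\<delta> * \<bar>r\<bar> - \<bar>p\<bar>)"
  proof (cases "\<exists>i\<in>{1..N}. \<exists>j\<in>{1..N}. i < j \<and> 0 < hat i \<and> 0 < hat j")
    case True
    then obtain i j where ij: "i \<in> {1..N}" "j \<in> {1..N}" "i < j" "0 < hat i" "0 < hat j" by blast
    have near: "\<bar>p + i * q\<bar> < \<epsilon> * \<bar>r\<bar>" "\<bar>p + j * q\<bar> < \<epsilon> * \<bar>r\<bar>"
      using ij by (auto simp: hat_def max_def split: if_splits)
    have eq: "(p + j * q) - (p + i * q) = real (j - i) * q"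
      using ij(3) by (simp add: of_nat_diff left_diff_distrib)
    \<comment> \<open>Subtracting the two small quantities bounds \<open>q\<close>; going back from
      index \<open>i\<close>, at most \<open>N\<close>, then bounds \<open>p\<close>. This is the
      origin of the factor 2 N + 1.\<close>
    have "1 * \<bar>q\<bar> \<le> real (j - i) * \<bar>q\<bar>" using ij(3) by (intro mult_right_mono) auto
    also have "\<dots> = \<bar>(p + j * q) - (p + i * q)\<bar>"
      unfolding eq abs_mult by simp
    also have "\<dots> \<le> 2 * \<epsilon> * \<bar>r\<bar>" using near by linarith
    finally have q: "\<bar>q\<bar> \<le> 2 * \<epsilon> * \<bar>r\<bar>" by simp
    have "\<bar>i * q\<bar> \<le> N * (2 * \<epsilon> * \<bar>r\<bar>)"
      unfolding abs_mult using ij q by (intro mult_mono) auto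
    then have "\<bar>p\<bar> \<le> (2 * real N + 1) * \<epsilon> * \<bar>r\<bar>" using near(1) by (simp add: algebra_simps)
    then have "(\<delta> - (2 * real N + 1) * \<epsilon>) * \<bar>r\<bar> \<le> max 0 (\<delta> * \<bar>r\<bar> - \<bar>p\<bar>)" by (simp add: algebra_simps)
    then have "N * \<epsilon> / (\<delta> - (2 * real N + 1) * \<epsilon>) * ((\<delta> - (2 * real N + 1) * \<epsilon>) * \<bar>r\<bar>)
      \<le> N * \<epsilon> / (\<delta> - (2 * real N + 1) * \<epsilon>) * max 0 (\<delta> * \<bar>r\<bar> - \<bar>p\<bar>)"
      using assms by (intro mult_left_mono divide_nonneg_pos) auto
    moreover have "sum hat {1..N} \<le> N * (\<epsilon> * \<bar>r\<bar>)"
      using sum_bounded_above[of "{1..N}" hat] hat(2) by simp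
    moreover have "N * \<epsilon> / (\<delta> - (2 * real N + 1) * \<epsilon>) * ((\<delta> - (2 * real N + 1) * \<epsilon>) * \<bar>r\<bar>) = N * (\<epsilon> * \<bar>r\<bar>)"
      using assms by simp
    moreover have "0 \<le> \<epsilon> * \<bar>r\<bar>" using assms by simp
    ultimately show ?thesis by linarith
  next
    case False
    have "sum hat {1..N} \<le> \<epsilon> * \<bar>r\<bar>"
    proof (cases "\<exists>i\<in>{1..N}. 0 < hat i")
      case True
      then obtain i where i: "i \<in> {1..N}" "0 < hat i" by blast
      have "hat j = 0" if "j \<in> {1..N} - {i}" for j
        using False i that hat(1)[of j] by (metis Diff_iff insertI1 less_le linorder_neqE_nat)
      then have "sum hat {1..N} = hat i"
        using i sum.remove[of "{1..N}" i hat] by simp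
      then show ?thesis using hat(2) by simp
    next
      case False
      then have "sum hat {1..N} \<le> 0" by (intro sum_nonpos) force
      then show ?thesis using assms by (meson abs_ge_zero less_imp_le mult_nonneg_nonneg order_trans)
    qed
    then show ?thesis using rest by linarith
  qed
  then show ?thesis by (simp add: hat_def)
qed

text \<open>Both sides are additive under Minkowski sums and continuous in the support function, so
  a single segment suffices. A segment enters the i-th term on the left only if it is nearly
  orthogonal to x + i y. If it enters once, the first term on the right pays for it; if it enters
  twice, it is nearly orthogonal to \<open>x\<close> too and the second term pays.\<close>

lemma zonoid_sum_second_diff_le:
  fixes K :: "'a::euclidean_space set"
  assumes "zonoid K" "0 < \<epsilon>" "(2 * real N + 1) * \<epsilon> < \<delta>"
  shows "(\<Sum>i=1..N. second_diff (support_fun K) (x + real i *\<^sub>R y) (\<epsilon> *\<^sub>R z))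
    \<le> \<epsilon> * second_diff (support_fun K) 0 z
       + N * \<epsilon> / (\<delta> - (2 * real N + 1) * \<epsilon>) * second_diff (support_fun K) x (\<delta> *\<^sub>R z)"
proof -
  define \<kappa> where "\<kappa> = N * \<epsilon> / (\<delta> - (2 * real N + 1) * \<epsilon>)"
  have zonotope: "(\<Sum>i=1..N. second_diff (support_fun Z) (x + real i *\<^sub>R y) (\<epsilon> *\<^sub>R z))
    \<le> \<epsilon> * second_diff (support_fun Z) 0 z
       + \<kappa> * second_diff (support_fun Z) x (\<delta> *\<^sub>R z)"
    if "zonotope Z" for Z
    using that
  proof (induction rule: zonotope_induct)
    case zero
    then show ?case by (simp add: second_diff_def support_fun_def)
  next
    case (plus Z p q)
    let ?w = "q - p"
    have Z: "compact Z" "Z \<noteq> {}" using plus(1) zonotope_compact_convex by auto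
    have \<delta>: "0 < \<delta>" using assms(2,3) by (smt (verit) mult_pos_pos of_nat_0_le_iff)
    \<comment> \<open>\<open>sum_hat_le\<close> with the inner products of the segment vector
      \<open>?w\<close> with \<open>x\<close>, \<open>y\<close>, \<open>z\<close> in place of its p,
      q, r.\<close>
    have "(\<Sum>i=1..N. max 0 (\<epsilon> * \<bar>?w \<bullet> z\<bar> - \<bar>?w \<bullet> x + i * (?w \<bullet> y)\<bar>))
      \<le> \<epsilon> * \<bar>?w \<bullet> z\<bar> + \<kappa> * max 0 (\<delta> * \<bar>?w \<bullet> z\<bar> - \<bar>?w \<bullet> x\<bar>)"
      unfolding \<kappa>_def using assms(2,3) by (rule sum_hat_le)
    then have "(\<Sum>i=1..N. second_diff (support_fun (closed_segment p q)) (x + real i *\<^sub>R y) (\<epsilon> *\<^sub>R z))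
      \<le> \<epsilon> * second_diff (support_fun (closed_segment p q)) 0 z
       + \<kappa> * second_diff (support_fun (closed_segment p q)) x (\<delta> *\<^sub>R z)"
      using assms(2) \<delta>
      by (simp add: second_diff_support_fun_segment inner_add_right abs_mult flip: sum_divide_distrib)
    then show ?case
      using plus(2) second_diff_support_fun_plus[OF Z, of "closed_segment p q"]
      by (simp add: sum.distrib distrib_left)
  qed
  obtain Z where Z: "\<And>m. zonotope (Z m)" "hausdorff_tendsto Z K" and K: "compact K" "K \<noteq> {}"
    using assms(1) unfolding zonoid_def by blast
  have lim: "(\<lambda>m. second_diff (support_fun (Z m)) u v) \<longlonglongrightarrow> second_diff (support_fun K) u v" for u v
    unfolding second_diff_def using Z zonotope_compact_convex K
    by (intro tendsto_intros support_fun_tendsto) auto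
  show ?thesis
    unfolding \<kappa>_def[symmetric]
  proof (rule LIMSEQ_le)
    show "(\<lambda>m. \<Sum>i=1..N. second_diff (support_fun (Z m)) (x + real i *\<^sub>R y) (\<epsilon> *\<^sub>R z))
      \<longlonglongrightarrow> (\<Sum>i=1..N. second_diff (support_fun K) (x + real i *\<^sub>R y) (\<epsilon> *\<^sub>R z))"
      by (intro tendsto_sum lim)
    show "(\<lambda>m. \<epsilon> * second_diff (support_fun (Z m)) 0 z + \<kappa> * second_diff (support_fun (Z m)) x (\<delta> *\<^sub>R z))
      \<longlonglongrightarrow> \<epsilon> * second_diff (support_fun K) 0 z + \<kappa> * second_diff (support_fun K) x (\<delta> *\<^sub>R z)"
      by (intro tendsto_intros lim)
  qed (use zonotope Z in blast)
qed

text \<open>Because \<open>F\<close> sees only the sum of the last two absolute coordinates, moving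
  from e1 + t e2 by r e3, in either sense, has the effect of moving by r e2. Second differences
  along \<open>e3\<close> are therefore increments of \<open>g\<close>, and the preceding inequality
  bounds slopes of \<open>g\<close> far out by its slopes near 0. Convexity gives the opposite
  bound, so \<open>g\<close> is affine on the half line.\<close>

lemma zonoid_gauge_linear:
  fixes K :: "'a::euclidean_space set" and F :: "real \<Rightarrow> real \<Rightarrow> real"
  assumes K: "K \<in> sym_zonoids"
    and e: "norm e1 = 1" "norm e2 = 1" "norm e3 = 1" "e1 \<bullet> e2 = 0" "e1 \<bullet> e3 = 0" "e2 \<bullet> e3 = 0"
    and supp: "\<And>x. support_fun K x = F \<bar>e1 \<bullet> x\<bar> (\<bar>e2 \<bullet> x\<bar> + \<bar>e3 \<bullet> x\<bar>)"
    and st: "0 \<le> s" "0 \<le> t"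
  shows "F s t = s * F 1 0 + t * F 0 1"
proof -
  note K' = sym_zonoidsD[OF K]
  let ?h = "support_fun K"
  have h: "?h (x *\<^sub>R e1 + y *\<^sub>R e2 + z *\<^sub>R e3) = F \<bar>x\<bar> (\<bar>y\<bar> + \<bar>z\<bar>)" for x y z
    using e by (simp add: supp inner_add_right inner_commute[of e2 e1] inner_commute[of e3 e1]
        inner_commute[of e3 e2] norm_eq_1)
  have hom: "F (c * s) (c * t) = c * F s t" if "0 \<le> c" "0 \<le> s" "0 \<le> t" for c s t
    using support_fun_scaleR[OF K'(2,3) that(1), of "s *\<^sub>R e1 + t *\<^sub>R e2"] that
      h[of s t 0] h[of "c * s" "c * t" 0] by (simp add: scaleR_add_right)
  \<comment> \<open>\<open>g\<close> is the even extension of \<open>F 1\<close> to all reals; it is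
    convex on the whole line as a restriction of a support function.\<close>
  define g where "g b = ?h (e1 + b *\<^sub>R e2)" for b
  have h0: "?h 0 = 0" using support_fun_abs_scaleR[OF K, of 0 0] by simp
  have F01: "0 \<le> F 0 1" and F10: "0 \<le> F 1 0"
    using h[of 0 1 0] h[of 1 0 0] support_fun_sym_nonneg[OF K] by (metis abs_0 abs_1 add_0_right)+
  have conv: "convex_on UNIV g"
    unfolding g_def
  proof (rule convex_onI)
    fix t x y :: real assume t: "0 < t" "t < 1"
    have "?h (e1 + ((1 - t) *\<^sub>R x + t *\<^sub>R y) *\<^sub>R e2)
      = ?h ((1 - t) *\<^sub>R (e1 + x *\<^sub>R e2) + t *\<^sub>R (e1 + y *\<^sub>R e2))"
      by (simp add: algebra_simps)
    also have "\<dots> \<le> (1 - t) * ?h (e1 + x *\<^sub>R e2) + t * ?h (e1 + y *\<^sub>R e2)"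
      using support_fun_add_le[OF K'(2,3)] support_fun_scaleR[OF K'(2,3)] t
      by (metis diff_ge_0_iff_ge less_imp_le)
    finally show "?h (e1 + ((1 - t) *\<^sub>R x + t *\<^sub>R y) *\<^sub>R e2)
      \<le> (1 - t) * ?h (e1 + x *\<^sub>R e2) + t * ?h (e1 + y *\<^sub>R e2)" .
  qed simp
  have g: "g b = F 1 b" if "0 \<le> b" for b
    using h[of 1 b 0] that by (simp add: g_def)
  \<comment> \<open>By convexity the chord slopes from 0 increase up to \<open>c\<close>, and the
    slope beyond \<open>c\<close> is at least the chord slope ending there.\<close>
  have slope: "(g b - g 0) / b \<le> (g (c + \<epsilon>) - g c) / \<epsilon>" if b: "0 < b" "b \<le> c" and \<epsilon>: "0 < \<epsilon>" for b c \<epsilon>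
  proof -
    have "(g b - g 0) / b \<le> (g c - g 0) / c"
    proof (cases "b = c")
      case False
      then show ?thesis
        using convex_on_slope_le(1)[OF conv, of 0 c b] b by (simp add: field_simps)
    qed simp
    also have "\<dots> \<le> (g (c + \<epsilon>) - g c) / \<epsilon>"
      using convex_on_slope_le[OF conv, of 0 "c + \<epsilon>" c] b \<epsilon> by (simp add: field_simps)
    finally show ?thesis .
  qed
  have slope_le: "(g b - g 0) / b \<le> (g \<delta> - g 0) / \<delta>" if b: "0 < b" and \<delta>: "0 < \<delta>" for b \<delta>
  proof -
    have bound: "(g b - g 0) / b \<le> F 0 1 * (1 / Suc n) + (g \<delta> - g 0) / \<delta> * (1 + 1 / Suc n)" for n
    proof -
      let ?N = "Suc n"
      \<comment> \<open>Chosen so that (2 N + 1) \<epsilon> = \<delta> / (N + 1). The denominator in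
        the second term is then \<delta> N / (N + 1), with reciprocal (1 + 1/N) / \<delta>.\<close>
      define \<epsilon> where "\<epsilon> = \<delta> / ((2 * real ?N + 1) * (real ?N + 1))"
      have \<epsilon>: "0 < \<epsilon>" using \<delta> by (simp add: \<epsilon>_def)
      have cancel: "a * (\<delta> / (a * b)) = \<delta> / b" if "a \<noteq> 0" for a b using that by simp
      have N: "(2 * real ?N + 1) * \<epsilon> = \<delta> / (real ?N + 1)"
        unfolding \<epsilon>_def using cancel[of "2 * real ?N + 1" "real ?N + 1"] by simp
      have less: "(2 * real ?N + 1) * \<epsilon> < \<delta>"
        unfolding N using \<delta> by (simp add: field_simps add_pos_nonneg)
      have diff: "\<delta> - (2 * real ?N + 1) * \<epsilon> = \<delta> * ?N / (?N + 1)"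
        unfolding N by (simp add: field_simps)
      have sd: "second_diff ?h (e1 + t *\<^sub>R e2) (r *\<^sub>R e3) = g (t + r) - g t" if "0 \<le> t" "0 \<le> r" for t r
        using h[of 1 t r] h[of 1 t "- r"] h[of 1 t 0] that by (simp add: second_diff_def g)
      have sd0: "second_diff ?h 0 e3 = F 0 1"
        using h[of 0 0 1] h[of 0 0 "- 1"] by (simp add: second_diff_def h0)
      \<comment> \<open>The points e1 + i b e2 give \<open>?N\<close> increments of
        \<open>g\<close>, each at least \<epsilon> times the chord slope to \<open>b\<close>.
        Dividing by N \<epsilon> at the end leaves \<open>F 0 1\<close> divided by N, which vanishes
        in the limit.\<close>
      have "?N * (\<epsilon> * ((g b - g 0) / b)) = (\<Sum>i=1..?N. \<epsilon> * ((g b - g 0) / b))" by simp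
      also have "\<dots> \<le> (\<Sum>i=1..?N. second_diff ?h (e1 + real i *\<^sub>R (b *\<^sub>R e2)) (\<epsilon> *\<^sub>R e3))"
      proof (rule sum_mono)
        fix i assume i: "i \<in> {1..?N}"
        then have "b \<le> i * b" using b by simp
        then show "\<epsilon> * ((g b - g 0) / b) \<le> second_diff ?h (e1 + real i *\<^sub>R (b *\<^sub>R e2)) (\<epsilon> *\<^sub>R e3)"
          using slope[OF b, of "i * b" \<epsilon>] \<epsilon> sd[of "i * b" \<epsilon>] b by (simp add: pos_le_divide_eq mult.commute)
      qed
      also have "\<dots> \<le> \<epsilon> * F 0 1 + ?N * \<epsilon> / (\<delta> - (2 * real ?N + 1) * \<epsilon>) * (g \<delta> - g 0)"
        using zonoid_sum_second_diff_le[OF K'(1) \<epsilon> less, of e1 "b *\<^sub>R e2" e3] sd[of 0 \<delta>] \<delta>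
        unfolding sd0 by simp
      also have "\<dots> = (?N * \<epsilon>) * (F 0 1 * (1 / ?N) + (g \<delta> - g 0) / (\<delta> - (2 * real ?N + 1) * \<epsilon>))"
        by (simp add: field_simps)
      also have "(g \<delta> - g 0) / (\<delta> - (2 * real ?N + 1) * \<epsilon>) = (g \<delta> - g 0) / \<delta> * (1 + 1 / ?N)"
        unfolding diff using \<delta> by (simp add: field_simps)
      finally have "(?N * \<epsilon>) * ((g b - g 0) / b)
         \<le> (?N * \<epsilon>) * (F 0 1 * (1 / ?N) + (g \<delta> - g 0) / \<delta> * (1 + 1 / ?N))" by (simp add: mult.assoc)
      then show ?thesis using \<epsilon> by (simp only: mult_le_cancel_left_pos of_nat_0_less_iff zero_less_Suc mult_pos_pos)
    qed
    have "(\<lambda>n. F 0 1 * (1 / Suc n) + (g \<delta> - g 0) / \<delta> * (1 + 1 / Suc n))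
      \<longlonglongrightarrow> F 0 1 * 0 + (g \<delta> - g 0) / \<delta> * (1 + 0)"
      using LIMSEQ_inverse_real_of_nat unfolding inverse_eq_divide by (intro tendsto_intros)
    then show ?thesis using bound by (force intro: LIMSEQ_le_const)
  qed
  define c where "c = g 1 - g 0"
  have affine: "F 1 b = F 1 0 + b * c" if "0 \<le> b" for b
  proof (cases "b = 0")
    case False
    \<comment> \<open>The bound holds for every ordered pair of positive arguments, so exchanging
      them gives equality.\<close>
    then have "(g b - g 0) / b = g 1 - g 0" using slope_le[of b 1] slope_le[of 1 b] that by simp
    then show ?thesis using False g[OF that] by (simp add: c_def g field_simps)
  qed simp
  have pos: "F s t = s * F 1 0 + t * c" if "0 < s" "0 \<le> t" for s t
  proof -
    have "F s t = s * F 1 (t / s)" using hom[of s 1 "t / s"] that by simp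
    also have "\<dots> = s * F 1 0 + t * c"
      using affine[of "t / s"] that by (simp add: distrib_left)
    finally show ?thesis .
  qed
  \<comment> \<open>The case s = 0 escapes division by \<open>s\<close>. It is recovered by
    comparing the support function at \<open>e2\<close> and at r e1 + e2 for small r.\<close>
  have "F 0 1 = c"
  proof (rule order_antisym)
    have h1: "?h (r *\<^sub>R e1) = r * F 1 0" if "0 \<le> r" for r
      using h[of r 0 0] hom[of r 1 0] that by simp
    have h2: "?h e2 = F 0 1" using h[of 0 1 0] by simp
    have h3: "?h (r *\<^sub>R e1 + e2) = r * F 1 0 + c" if "0 < r" for r
      using h[of r 1 0] pos[of r 1] that by simp
    show "c \<le> F 0 1"
      using support_fun_add_le[OF K'(2,3), of "1 *\<^sub>R e1" e2] h1[of 1] h2 h3[of 1] by simp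
    show "F 0 1 \<le> c"
    proof (rule field_le_epsilon)
      fix \<eta> :: real assume "0 < \<eta>"
      \<comment> \<open>Makes 2 r F(1, 0) at most \<eta>; the added 1 guards against F(1, 0) =
        0.\<close>
      define r where "r = \<eta> / (2 * F 1 0 + 1)"
      have r: "0 < r" using \<open>0 < \<eta>\<close> F10 by (simp add: r_def)
      have "2 * (r * F 1 0) \<le> r * (2 * F 1 0 + 1)" using r by (simp add: algebra_simps)
      also have "\<dots> = \<eta>" using F10 by (simp add: r_def)
      finally show "F 0 1 \<le> c + \<eta>"
        using support_fun_add_le[OF K'(2,3), of "r *\<^sub>R e1 + e2" "- (r *\<^sub>R e1)"]
          support_fun_uminus[OF K, of "r *\<^sub>R e1"] h1[of r] h2 h3[OF r] r by simp
    qed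
  qed
  then show ?thesis
    using pos[of s t] hom[of t 0 1] st by (cases "s = 0") auto
qed

section \<open>Projection covariant operations\<close>

abbreviation sym_segment :: "'a::euclidean_space \<Rightarrow> 'a set" where
  "sym_segment w \<equiv> closed_segment (- w) w"

definition minkowski_comb :: "real \<Rightarrow> real \<Rightarrow> 'a::euclidean_space set \<Rightarrow> 'a set \<Rightarrow> 'a set" where
  "minkowski_comb a b K L = (*\<^sub>R) a ` K + (*\<^sub>R) b ` L"

lemma minkowski_comb_linear_image:
  assumes "linear f" shows "f ` minkowski_comb a b K L = minkowski_comb a b (f ` K) (f ` L)"
  by (simp add: minkowski_comb_def linear_image_plus[OF assms] image_image linear_scale[OF assms])

text \<open>Supplies lines at a prescribed angle; projecting from one line to another rescales
  lengths by the cosine \<open>r\<close>.\<close>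

lemma exists_unit_vector_inner_eq:
  fixes w :: "'a::euclidean_space"
  assumes "2 \<le> DIM('a)" "norm w = 1" "0 \<le> r" "r \<le> 1"
  obtains u where "norm u = 1" "w \<bullet> u = r"
proof -
  obtain v where v: "v \<noteq> 0" "orthogonal w v" using orthogonal_to_vector_exists[OF assms(1)] .
  define v' where "v' = v /\<^sub>R norm v"
  have v': "v' \<bullet> v' = 1" "w \<bullet> v' = 0" "v' \<bullet> w = 0" "w \<bullet> w = 1"
    using v assms(2) by (simp_all add: v'_def orthogonal_def inner_commute dot_square_norm field_simps)
  define u where "u = r *\<^sub>R w + sqrt (1 - r\<^sup>2) *\<^sub>R v'"
  have "u \<bullet> u = r\<^sup>2 + (sqrt (1 - r\<^sup>2))\<^sup>2"
    by (simp add: u_def inner_add_left inner_add_right v' power2_eq_square)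
  also have "\<dots> = 1" using assms(3,4) by (simp add: power_le_one)
  finally have "norm u = 1" by (simp add: norm_eq_1)
  moreover have "w \<bullet> u = r" by (simp add: u_def inner_add_right v')
  ultimately show thesis using that by blast
qed

text \<open>On each line the operation is a function of two half lengths. Projecting one line onto
  another relates these functions, which makes them homogeneous and then independent of the
  line.\<close>

lemma projection_covariant_support_fun:
  fixes star :: "'a::euclidean_space set \<Rightarrow> 'a set \<Rightarrow> 'a set"
  assumes dim: "2 \<le> DIM('a)"
    and closed: "\<And>K L. K \<in> sym_zonoids \<Longrightarrow> L \<in> sym_zonoids \<Longrightarrow> star K L \<in> sym_zonoids"
    and proj: "projection_covariant star"
  shows "\<exists>F. \<forall>K\<in>sym_zonoids. \<forall>L\<in>sym_zonoids. \<forall>x.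
      support_fun (star K L) x = F (support_fun K x) (support_fun L x)"
proof -
  define \<phi> where "\<phi> u s t = support_fun (star (sym_segment (s *\<^sub>R u)) (sym_segment (t *\<^sub>R u))) u" for u s t
  have line: "star (sym_segment (support_fun K u *\<^sub>R u)) (sym_segment (support_fun L u *\<^sub>R u))
      = sym_segment (support_fun (star K L) u *\<^sub>R u)"
    if KL: "K \<in> sym_zonoids" "L \<in> sym_zonoids" and u: "norm u = 1" for K L u
  proof -
    have "u \<noteq> 0" using u by auto
    then have "dim (span {u}) = 1" by (simp add: dim_insert)
    then have "set_proj (star K L) (span {u}) = star (set_proj K (span {u})) (set_proj L (span {u}))"
      using proj KL dim unfolding projection_covariant_def by simp
    then show ?thesis using KL u closed by (simp add: set_proj_line_sym_zonoid)
  qed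
  have \<phi>: "\<phi> u (support_fun K u) (support_fun L u) = support_fun (star K L) u"
    if "K \<in> sym_zonoids" "L \<in> sym_zonoids" and u: "norm u = 1" for K L u
    using line[OF that] support_fun_sym_nonneg[OF closed[OF that(1,2)], of u] u
    by (simp add: \<phi>_def support_fun_symmetric_segment flip: norm_eq_1)
  have seg: "support_fun (sym_segment (s *\<^sub>R w)) u = s * \<bar>w \<bullet> u\<bar>" if "0 \<le> s" for s and w u :: 'a
    using that by (simp add: support_fun_symmetric_segment abs_mult)
  have \<phi>_nonneg: "0 \<le> \<phi> u s t" for u s t
    unfolding \<phi>_def by (intro support_fun_sym_nonneg closed sym_zonoids_segment)
  have self: "w \<bullet> w = 1" if "norm w = 1" for w :: 'a using that by (simp add: norm_eq_1)
  have change: "\<phi> u (\<bar>w \<bullet> u\<bar> * s) (\<bar>w \<bullet> u\<bar> * t) = \<bar>w \<bullet> u\<bar> * \<phi> w s t"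
    if u: "norm u = 1" and w: "norm w = 1" and st: "0 \<le> s" "0 \<le> t" for u w s t
  proof -
    let ?K = "sym_segment (s *\<^sub>R w)" and ?L = "sym_segment (t *\<^sub>R w)"
    \<comment> \<open>Two segments on the line of \<open>w\<close> are their own projections to it,
      so the operation returns a segment on that line. This segment is then projected to the line of
      \<open>u\<close>.\<close>
    have eq: "star ?K ?L = sym_segment (\<phi> w s t *\<^sub>R w)"
      using line[OF sym_zonoids_segment sym_zonoids_segment w, of "s *\<^sub>R w" "t *\<^sub>R w"] seg[of s w w] seg[of t w w] st
        self[OF w] by (simp add: \<phi>_def)
    have "\<phi> u (support_fun ?K u) (support_fun ?L u) = support_fun (star ?K ?L) u"
      using \<phi>[OF sym_zonoids_segment sym_zonoids_segment u] .
    then show ?thesis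
      unfolding eq seg[OF st(1)] seg[OF st(2)] seg[OF \<phi>_nonneg] by (simp add: mult.commute)
  qed
  have hom1: "\<phi> w (c * s) (c * t) = c * \<phi> w s t"
    if w: "norm w = 1" and c: "0 \<le> c" "c \<le> 1" and st: "0 \<le> s" "0 \<le> t" for w c s t
  proof -
    \<comment> \<open>Going to a line at cosine sqrt c and back multiplies by c. Factors above 1 are
      handled below through their reciprocals.\<close>
    obtain u where u: "norm u = 1" "w \<bullet> u = sqrt c"
      using exists_unit_vector_inner_eq[OF dim w, of "sqrt c"] c by auto
    have "\<phi> u (sqrt c * s) (sqrt c * t) = sqrt c * \<phi> w s t"
      using change[OF u(1) w st] u(2) c by simp
    moreover have "\<phi> w (sqrt c * (sqrt c * s)) (sqrt c * (sqrt c * t)) = sqrt c * \<phi> u (sqrt c * s) (sqrt c * t)"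
      using change[OF w u(1), of "sqrt c * s" "sqrt c * t"] u(2) c st by (simp add: inner_commute)
    ultimately show ?thesis using c by (simp add: mult.assoc[symmetric])
  qed
  have hom: "\<phi> w (c * s) (c * t) = c * \<phi> w s t"
    if w: "norm w = 1" and c: "0 \<le> c" and st: "0 \<le> s" "0 \<le> t" for w c s t
  proof (cases "c \<le> 1")
    case False
    then show ?thesis using hom1[OF w, of "1 / c" "c * s" "c * t"] st by (simp add: field_simps)
  qed (use hom1 that in blast)
  have nonorth: "\<phi> u s t = \<phi> w s t"
    if "norm u = 1" "norm w = 1" "w \<bullet> u \<noteq> 0" "0 \<le> s" "0 \<le> t" for u w s t
    using change[OF that(1,2,4,5)] hom[OF that(1), of "\<bar>w \<bullet> u\<bar>" s t] that by simp
  have indep: "\<phi> u s t = \<phi> w s t"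
    if u: "norm u = 1" and w: "norm w = 1" and st: "0 \<le> s" "0 \<le> t" for u w s t
  proof (cases "w \<bullet> u = 0")
    case True
    \<comment> \<open>The unit vector halfway between \<open>u\<close> and \<open>w\<close> is
      orthogonal to neither, so both are compared with it.\<close>
    define v where "v = (u + w) /\<^sub>R sqrt 2"
    have *: "u \<bullet> w = 0" using True by (simp add: inner_commute)
    have "v \<bullet> v = 1"
      by (simp add: v_def inner_add_left inner_add_right True * self u w field_simps)
    moreover have "v \<bullet> u \<noteq> 0" "w \<bullet> v \<noteq> 0"
      by (simp_all add: v_def inner_add_left inner_add_right True * self u w)
    ultimately show ?thesis using nonorth[OF u _ _ st, of v] nonorth[OF _ w _ st, of v] by (simp add: norm_eq_1)
  qed (use nonorth that in blast)
  obtain e :: 'a where e: "norm e = 1" using vector_choose_size zero_le_one by blast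
  show ?thesis
  proof (intro exI[of _ "\<phi> e"] ballI allI)
    fix K L :: "'a set" and x :: 'a
    assume KL: "K \<in> sym_zonoids" "L \<in> sym_zonoids"
    define u where "u = (if x = 0 then e else x /\<^sub>R norm x)"
    have u: "norm u = 1" and x: "x = norm x *\<^sub>R u" using e by (auto simp: u_def)
    have scale: "support_fun M x = norm x * support_fun M u" if "M \<in> sym_zonoids" for M
      using support_fun_abs_scaleR[OF that, of "norm x" u] x by simp
    show "support_fun (star K L) x = \<phi> e (support_fun K x) (support_fun L x)"
      using \<phi>[OF KL u] indep[OF u e] hom[OF e, of "norm x" "support_fun K u" "support_fun L u"]
        scale KL closed[OF KL] support_fun_sym_nonneg[OF KL(1)] support_fun_sym_nonneg[OF KL(2)] by simp
  qed
qed

lemma orthonormal_triple: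
  assumes "3 \<le> DIM('a)"
  obtains e1 e2 e3 :: "'a::euclidean_space"
  where "norm e1 = 1" "norm e2 = 1" "norm e3 = 1" "e1 \<bullet> e2 = 0" "e1 \<bullet> e3 = 0" "e2 \<bullet> e3 = 0"
proof -
  obtain T :: "'a set" where T: "T \<subseteq> Basis" "card T = 3"
    using obtain_subset_with_card_n[OF assms] .
  obtain e1 e2 e3 where e: "T = {e1, e2, e3}" "e1 \<noteq> e2" "e2 \<noteq> e3" "e1 \<noteq> e3"
    using T(2)[unfolded card_3_iff] by (elim exE conjE) (rule that)
  have "e1 \<in> Basis" "e2 \<in> Basis" "e3 \<in> Basis" using T(1) unfolding e(1) by simp_all
  then show thesis using e(2-4) that[of e1 e2 e3] by (simp add: inner_not_same_Basis)
qed

lemma projection_covariant_imp_minkowski_comb: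
  fixes star :: "'a::euclidean_space set \<Rightarrow> 'a set \<Rightarrow> 'a set"
  assumes dim: "3 \<le> DIM('a)"
    and closed: "\<And>K L. K \<in> sym_zonoids \<Longrightarrow> L \<in> sym_zonoids \<Longrightarrow> star K L \<in> sym_zonoids"
    and proj: "projection_covariant star"
  shows "\<exists>a b. 0 \<le> a \<and> 0 \<le> b \<and> (\<forall>K\<in>sym_zonoids. \<forall>L\<in>sym_zonoids. star K L = minkowski_comb a b K L)"
proof -
  have "\<exists>F. \<forall>K\<in>sym_zonoids. \<forall>L\<in>sym_zonoids. \<forall>x.
      support_fun (star K L) x = F (support_fun K x) (support_fun L x)"
    by (rule projection_covariant_support_fun) (use dim closed proj in simp_all)
  then obtain F where F: "\<And>K L x. K \<in> sym_zonoids \<Longrightarrow> L \<in> sym_zonoids \<Longrightarrow>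
      support_fun (star K L) x = F (support_fun K x) (support_fun L x)"
    by blast
  obtain e1 e2 e3 :: 'a
    where e: "norm e1 = 1" "norm e2 = 1" "norm e3 = 1" "e1 \<bullet> e2 = 0" "e1 \<bullet> e3 = 0" "e2 \<bullet> e3 = 0"
    using orthonormal_triple[OF dim] .
  let ?K = "sym_segment e1" and ?L = "sym_segment e2 + sym_segment e3"
  have KL: "?K \<in> sym_zonoids" "?L \<in> sym_zonoids" by (rule sym_zonoids_segment sym_zonoids_segment_sum)+
  have supp: "support_fun (star ?K ?L) x = F \<bar>e1 \<bullet> x\<bar> (\<bar>e2 \<bullet> x\<bar> + \<bar>e3 \<bullet> x\<bar>)" for x
    by (simp add: F[OF KL] support_fun_symmetric_segment support_fun_plus)
  \<comment> \<open>One pair of zonoids yields linearity on the whole quadrant, and the same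
    \<open>F\<close> serves every other pair.\<close>
  have linear: "F s t = s * F 1 0 + t * F 0 1" if "0 \<le> s" "0 \<le> t" for s t
    using zonoid_gauge_linear[OF closed[OF KL] e supp that] .
  have pos: "0 \<le> F 1 0" "0 \<le> F 0 1"
    using support_fun_sym_nonneg[OF closed[OF KL], of e1] support_fun_sym_nonneg[OF closed[OF KL], of e2] e
    by (simp_all add: supp inner_commute[of e2 e1] inner_commute[of e3 e1] inner_commute[of e3 e2] norm_eq_1)
  have "star K L = minkowski_comb (F 1 0) (F 0 1) K L" if KL: "K \<in> sym_zonoids" "L \<in> sym_zonoids" for K L
  proof -
    note K = sym_zonoidsD[OF KL(1)] and L = sym_zonoidsD[OF KL(2)] and S = sym_zonoidsD[OF closed[OF KL]]
    have comb: "compact ((*\<^sub>R) a ` M)" "convex ((*\<^sub>R) a ` M)" "(*\<^sub>R) a ` M \<noteq> {}"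
      if "M \<in> sym_zonoids" for M :: "'a set" and a
      using sym_zonoidsD[OF that] by (auto intro: compact_scaling convex_scaling)
    have "support_fun (star K L) x = support_fun (minkowski_comb (F 1 0) (F 0 1) K L) x" for x
    proof -
      have "support_fun (star K L) x = support_fun K x * F 1 0 + support_fun L x * F 0 1"
        unfolding F[OF KL] by (intro linear support_fun_sym_nonneg KL)
      also have "\<dots> = support_fun (minkowski_comb (F 1 0) (F 0 1) K L) x"
        unfolding minkowski_comb_def support_fun_plus[OF comb(1,3)[OF KL(1)] comb(1,3)[OF KL(2)]]
          support_fun_scaleR_image[OF K(2,3) pos(1)] support_fun_scaleR_image[OF L(2,3) pos(2)] by simp
      finally show ?thesis .
    qed
    moreover have "compact (minkowski_comb (F 1 0) (F 0 1) K L)" "minkowski_comb (F 1 0) (F 0 1) K L \<noteq> {}"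
      "convex (minkowski_comb (F 1 0) (F 0 1) K L)"
      unfolding minkowski_comb_def
      using comb[OF KL(1)] comb[OF KL(2)] by (simp_all add: compact_set_plus convex_set_plus set_plus_eq_empty)
    ultimately show ?thesis using S(2-4) by (intro support_fun_inject)
  qed
  then show ?thesis using pos by blast
qed

section \<open>Properties of Minkowski combinations, and from continuity to projection
  covariance\<close>

lemma minkowski_comb_projection_covariant:
  assumes "\<And>K L. K \<in> sym_zonoids \<Longrightarrow> L \<in> sym_zonoids \<Longrightarrow> star K L = minkowski_comb a b K L"
  shows "projection_covariant star"
  unfolding projection_covariant_def
proof (intro ballI allI impI)
  fix K L S :: "'a set"
  assume KL: "K \<in> sym_zonoids" "L \<in> sym_zonoids" and S: "subspace S \<and> 1 \<le> dim S \<and> dim S \<le> DIM('a) - 1"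
  have "subspace S" using S by simp
  then obtain P where P: "linear P \<and> (\<forall>x. 0 \<le> x \<bullet> P x) \<and> (\<forall>X. set_proj X S = P ` X)"
    by (rule exE[OF set_proj_eq_linear_image])
  then show "set_proj (star K L) S = star (set_proj K S) (set_proj L S)"
    using P by (simp add: assms KL sym_zonoids_linear_image minkowski_comb_linear_image)
qed

lemma minkowski_comb_GL_covariant:
  assumes "\<And>K L. K \<in> sym_zonoids \<Longrightarrow> L \<in> sym_zonoids \<Longrightarrow> star K L = minkowski_comb a b K L"
  shows "GL_covariant star"
  unfolding GL_covariant_def
  by (simp add: assms sym_zonoids_linear_image minkowski_comb_linear_image)

lemma minkowski_comb_hausdorff_continuous:
  assumes "\<And>K L. K \<in> sym_zonoids \<Longrightarrow> L \<in> sym_zonoids \<Longrightarrow> star K L = minkowski_comb a b K L"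
  shows "hausdorff_continuous star"
  unfolding hausdorff_continuous_def
proof (intro ballI allI impI)
  fix X Y :: "nat \<Rightarrow> 'a set" and M N
  assume MN: "M \<in> sym_zonoids" "N \<in> sym_zonoids"
    and XY: "(\<forall>m. X m \<in> sym_zonoids \<and> Y m \<in> sym_zonoids) \<and> hausdorff_tendsto X M \<and> hausdorff_tendsto Y N"
  have lin: "linear ((*\<^sub>R) c)" for c :: real by (rule linear_scale_self)
  have "hausdorff_tendsto (\<lambda>m. minkowski_comb a b (X m) (Y m)) (minkowski_comb a b M N)"
    unfolding minkowski_comb_def
    using XY MN sym_zonoidsD(2,3)
    by (intro hausdorff_tendsto_plus hausdorff_tendsto_linear_image lin) (auto intro!: compact_scaling)
  then show "hausdorff_tendsto (\<lambda>m. star (X m) (Y m)) (star M N)"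
    using XY MN by (simp add: assms)
qed

lemma continuous_GL_covariant_imp_projection_covariant:
  fixes star :: "'a::euclidean_space set \<Rightarrow> 'a set \<Rightarrow> 'a set"
  assumes closed: "\<And>K L. K \<in> sym_zonoids \<Longrightarrow> L \<in> sym_zonoids \<Longrightarrow> star K L \<in> sym_zonoids"
    and cont: "hausdorff_continuous star" and GL: "GL_covariant star"
  shows "projection_covariant star"
  unfolding projection_covariant_def
proof (intro ballI allI impI)
  fix K L S :: "'a set"
  assume KL: "K \<in> sym_zonoids" "L \<in> sym_zonoids" and S: "subspace S \<and> 1 \<le> dim S \<and> dim S \<le> DIM('a) - 1"
  have "subspace S" using S by simp
  then obtain P where "linear P \<and> (\<forall>x. 0 \<le> x \<bullet> P x) \<and> (\<forall>X. set_proj X S = P ` X)"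
    by (rule exE[OF set_proj_eq_linear_image])
  then have P: "linear P" "\<And>x. 0 \<le> x \<bullet> P x" "\<And>X. set_proj X S = P ` X" by simp_all
  define \<phi> where "\<phi> m x = P x + (1 / Suc m) *\<^sub>R x" for m x
  have lin: "linear (\<phi> m)" for m
    unfolding \<phi>_def by (intro linear_compose_add P(1) linear_scale_self)
  have "inj (\<phi> m)" for m
    unfolding linear_injective_0[OF lin]
  proof (intro allI impI)
    fix x assume "\<phi> m x = 0"
    then have "x \<bullet> (P x + (1 / Suc m) *\<^sub>R x) = 0" by (simp add: \<phi>_def)
    then have "x \<bullet> P x + (1 / Suc m) * (x \<bullet> x) = 0" by (simp only: inner_add_right inner_scaleR_right)
    then have "(1 / Suc m) * (x \<bullet> x) \<le> 0" using P(2)[of x] by linarith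
    then show "x = 0" using inner_ge_zero[of x] by (simp add: divide_le_0_iff order_antisym)
  qed
  then have bij: "bij (\<phi> m)" for m
    by (simp add: bij_def linear_injective_imp_surjective[OF lin])
  have mem: "\<phi> m ` M \<in> sym_zonoids" "P ` M \<in> sym_zonoids" if "M \<in> sym_zonoids" for m M
    using sym_zonoids_linear_image[OF that lin] sym_zonoids_linear_image[OF that P(1)] .
  have lim: "hausdorff_tendsto (\<lambda>m. \<phi> m ` M) (P ` M)" if M: "M \<in> sym_zonoids" for M
  proof -
    \<comment> \<open>Boundedness of \<open>M\<close> makes the convergence of the maps uniform on
      it, with error at most B / (m + 1).\<close>
    obtain B where B: "\<And>x. x \<in> M \<Longrightarrow> norm x \<le> B"
      using compact_imp_bounded[OF sym_zonoidsD(2)[OF M]] by (auto simp: bounded_iff)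
    have near: "dist (\<phi> m x) (P x) \<le> B * (1 / Suc m)" "dist (P x) (\<phi> m x) \<le> B * (1 / Suc m)" if "x \<in> M" for m x
      using B[OF that] by (simp_all add: \<phi>_def dist_norm divide_right_mono)
    show ?thesis
    proof (rule hausdorff_tendsto_le)
      show "hausdorff_dist (\<phi> m ` M) (P ` M) \<le> B * (1 / Suc m)" for m
      proof (rule hausdorff_dist_le)
        show "\<exists>y\<in>P ` M. dist x y \<le> B * (1 / Suc m)" if "x \<in> \<phi> m ` M" for x
          using that near(1) by blast
        show "\<exists>x\<in>\<phi> m ` M. dist y x \<le> B * (1 / Suc m)" if "y \<in> P ` M" for y
          using that near(2) by blast
      qed (use sym_zonoidsD(3)[OF M] in simp_all)
      show "(\<lambda>m. B * (1 / Suc m)) \<longlonglongrightarrow> 0"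
        using LIMSEQ_inverse_real_of_nat unfolding inverse_eq_divide by (rule tendsto_mult_right_zero)
    qed (simp_all add: mem[OF M] sym_zonoidsD(2,3) sym_zonoidsD(3)[OF M])
  qed
  have "hausdorff_tendsto (\<lambda>m. star (\<phi> m ` K) (\<phi> m ` L)) (star (P ` K) (P ` L))"
    using cont[unfolded hausdorff_continuous_def, rule_format, of "P ` K" "P ` L" "\<lambda>m. \<phi> m ` K" "\<lambda>m. \<phi> m ` L"]
    by (simp add: mem KL lim)
  moreover have "star (\<phi> m ` K) (\<phi> m ` L) = \<phi> m ` star K L" for m
    using GL lin bij KL unfolding GL_covariant_def by simp
  ultimately have "hausdorff_tendsto (\<lambda>m. \<phi> m ` star K L) (star (P ` K) (P ` L))" by simp
  then have "P ` star K L = star (P ` K) (P ` L)"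
    using lim[OF closed[OF KL]]
    by (intro hausdorff_tendsto_unique[of "\<lambda>m. \<phi> m ` star K L"])
      (simp_all add: mem closed KL sym_zonoidsD(2,3))
  then show "set_proj (star K L) S = star (set_proj K S) (set_proj L S)" by (simp add: P(3))
qed

theorem theorem5p1:
  fixes star :: "(real ^ 'n) set \<Rightarrow> (real ^ 'n) set \<Rightarrow> (real ^ 'n) set"
  assumes "CARD('n) \<ge> 3"
    and "\<And>K L. K \<in> sym_zonoids \<Longrightarrow> L \<in> sym_zonoids \<Longrightarrow> star K L \<in> sym_zonoids"
  shows "(projection_covariant star \<longleftrightarrow>
            (\<exists>a b. a \<ge> 0 \<and> b \<ge> 0 \<and>
              (\<forall>K\<in>sym_zonoids. \<forall>L\<in>sym_zonoids. star K L = (*\<^sub>R) a ` K + (*\<^sub>R) b ` L))) \<and>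
         (hausdorff_continuous star \<and> GL_covariant star \<longleftrightarrow>
            (\<exists>a b. a \<ge> 0 \<and> b \<ge> 0 \<and>
              (\<forall>K\<in>sym_zonoids. \<forall>L\<in>sym_zonoids. star K L = (*\<^sub>R) a ` K + (*\<^sub>R) b ` L)))"
proof -
  let ?comb = "\<exists>a b. a \<ge> 0 \<and> b \<ge> 0 \<and>
    (\<forall>K\<in>sym_zonoids. \<forall>L\<in>sym_zonoids. star K L = minkowski_comb a b K L)"
  have "projection_covariant star \<Longrightarrow> ?comb"
    by (rule projection_covariant_imp_minkowski_comb) (use assms in simp_all)
  moreover have "projection_covariant star \<and> hausdorff_continuous star \<and> GL_covariant star" if comb: ?comb
  proof -
    obtain a b where eq: "\<And>K L. K \<in> sym_zonoids \<Longrightarrow> L \<in> sym_zonoids \<Longrightarrow> star K L = minkowski_comb a b K L"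
      using comb by blast
    then show ?thesis
      using minkowski_comb_projection_covariant[of star, OF eq] minkowski_comb_GL_covariant[of star, OF eq]
        minkowski_comb_hausdorff_continuous[of star, OF eq] by blast
  qed
  moreover have "hausdorff_continuous star \<and> GL_covariant star \<Longrightarrow> projection_covariant star"
    using continuous_GL_covariant_imp_projection_covariant[of star, OF assms(2)] by blast
  ultimately show ?thesis unfolding minkowski_comb_def by argo
qed

end
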